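(* Let $G$ be a group such that the $6$-ary relation $R\subseteq G^6$ given by $R(x_1,x_2,x_3,y_1,y_2,y_3)\iff x_1x_2x_3=y_1y_2y_3$ has the strong Erdős–Hajnal property. Then there are constants $c_2>0$ and $\varepsilon_2\in(0,1)$ such that the following holds: if $X\subseteq G$ is finite, non-empty and distinct from $\{1\}$, and $k=|X^2|/|X|$, then $X$ contains a product-free subset of size at least $\varepsilon_2|X|/k^{c_2}$.
   Context: For a subset $X$ of a group, $X^2=\{xy: x,y\in X\}$. A subset $S$ of a group is product-free if $xy\notin S$ for all $x,y\in S$ (including $x=y$). Let $R\subseteq X_1\times\dots\times X_n$ be an $n$-ary relation on sets $X_1,\dots,X_n$. A tuple $(U_1,\dots,U_n)$ of subsets $U_i\subseteq X_i$ is $R$-homogeneous if $U_1\times\dots\times U_n$ is either a subset of $R$ or disjoint from $R$. The relation $R$ has the strong Erdős–Hajnal property if there exists a constant $\delta\in(0,1)$ such that for any finite subsets $W_i\subseteq X_i$ ($1\le i\le n$) there are subsets $U_i\subseteq W_i$, with $|U_i|\geqslant\delta|W_i|$ for each $i$, such that $(U_1,\dots,U_n)$ is $R$-homogeneous. The constants $c_2,\varepsilon_2$ may depend on $G$ but not on $X$. *)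

theory Defs
  imports "HOL-Algebra.Coset" Complex_Main
begin

text \<open>An \<open>n\<close>-ary relation on \<open>X 1, \<dots>, X n\<close> is a subset of \<open>\<Pi>\<^sub>E i\<in>{1..n}. X i\<close>: tuples are extensional
  functions on \<open>{1..n}\<close>.\<close>

definition homogeneous :: "nat \<Rightarrow> (nat \<Rightarrow> 'a) set \<Rightarrow> (nat \<Rightarrow> 'a set) \<Rightarrow> bool" where
  "homogeneous n R U \<longleftrightarrow>
     (\<Pi>\<^sub>E i\<in>{1..n}. U i) \<subseteq> R \<or> (\<Pi>\<^sub>E i\<in>{1..n}. U i) \<inter> R = {}"

definition strong_Erdos_Hajnal ::
    "nat \<Rightarrow> (nat \<Rightarrow> 'a set) \<Rightarrow> (nat \<Rightarrow> 'a) set \<Rightarrow> bool" where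
  "strong_Erdos_Hajnal n X R \<longleftrightarrow>
     (\<exists>\<delta>::real. 0 < \<delta> \<and> \<delta> < 1 \<and>
       (\<forall>W. (\<forall>i\<in>{1..n}. W i \<subseteq> X i \<and> finite (W i)) \<longrightarrow>
         (\<exists>U. (\<forall>i\<in>{1..n}. U i \<subseteq> W i \<and> real (card (U i)) \<ge> \<delta> * real (card (W i))) \<and>
              homogeneous n R U)))"

text \<open>The tuple \<open>(x\<^sub>1, x\<^sub>2, x\<^sub>3, y\<^sub>1, y\<^sub>2, y\<^sub>3)\<close> is indexed by \<open>1, \<dots>, 6\<close> in this order.\<close>

definition triple_product_relation :: "('a, 'b) monoid_scheme \<Rightarrow> (nat \<Rightarrow> 'a) set" where
  "triple_product_relation G =
     {z \<in> (\<Pi>\<^sub>E i\<in>{1..6}. carrier G).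
        z 1 \<otimes>\<^bsub>G\<^esub> z 2 \<otimes>\<^bsub>G\<^esub> z 3 = z 4 \<otimes>\<^bsub>G\<^esub> z 5 \<otimes>\<^bsub>G\<^esub> z 6}"

definition product_free :: "('a, 'b) monoid_scheme \<Rightarrow> 'a set \<Rightarrow> bool" where
  "product_free G S \<longleftrightarrow>
     S \<subseteq> carrier G \<and> (\<forall>x\<in>S. \<forall>y\<in>S. x \<otimes>\<^bsub>G\<^esub> y \<notin> S)"

end

theory Submission imports Defs begin

text \<open>
  The proof works with the ternary relation \<open>u v = z\<close>, the restriction of the \<open>6\<close>-ary one to tuples
  \<open>(u, v, 1, z, 1, 1)\<close>. Write \<open>n = |X|\<close>, and let \<open>U\<close>, \<open>V\<close> and \<open>A\<close> be subsets of \<open>X\<close>.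

  Suppose that \<open>Z\<close> is disjoint from \<open>U V\<close>, and that many triples \<open>(x, u, v)\<close> in \<open>A \<times> U \<times> V\<close>, a
  proportion polynomial in \<open>1/k\<close>, satisfy \<open>x u v \<in> Z\<close>. Some value \<open>l\<close> of \<open>u v\<close> is taken by many of them,
  so \<open>N = U \<inter> l V\<inverse>\<close> and \<open>Y = A \<inter> Z l\<inverse>\<close> are large. Since \<open>N N\<inverse> \<subseteq> U V l\<inverse>\<close> and \<open>U V\<close> misses \<open>Z\<close>, no
  element of \<open>Y\<close> lies in \<open>N N\<inverse>\<close>. Hence \<open>Y \<inter> N t\<close> is product-free for every \<open>t\<close>: an equation
  \<open>s\<^sub>1 s\<^sub>2 = s\<^sub>3\<close> in it would give \<open>s\<^sub>1 = s\<^sub>3 s\<^sub>2\<inverse> \<in> N N\<inverse>\<close>. A suitable \<open>t\<close> makes this set large. This is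
  \<open>product_free_from_solution_free\<close>.

  To find such \<open>U\<close>, \<open>V\<close>, \<open>Z\<close>, let \<open>P(U, V)\<close> be the set of popular products, those \<open>z\<close> with at least
  \<open>\<tau>\<close> representations \<open>z = x u v\<close>, and apply the Erdos-Hajnal property to \<open>(U, V, P(U, V))\<close>. It gives
  subsets \<open>U'\<close>, \<open>V'\<close>, \<open>Z\<close> of proportion \<open>\<delta>\<close> with \<open>Z\<close> disjoint from \<open>U' V'\<close>. Either \<open>Z\<close> meets
  \<open>P(U', V')\<close> in at least \<open>\<delta>/2 |P(U, V)|\<close> points, and the previous paragraph applies to \<open>(U', V', Z)\<close>,
  or \<open>|P(U', V')| \<le> (1 - \<delta>/2) |P(U, V)|\<close> and one repeats with \<open>(U', V')\<close>; this is
  \<open>product_free_or_fewer_popular\<close>. The repetition stops after \<open>O(log k)\<close> steps: \<open>P(U, V)\<close> starts inside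
  \<open>A A X\<close>, but always has at least \<open>|A|/2\<close> elements if \<open>\<tau>\<close> is small enough, because for fixed \<open>u\<close>,
  \<open>v\<close> the products \<open>x u v\<close> are pairwise distinct. Meanwhile \<open>U\<close> and \<open>V\<close> shrink only by a factor
  \<open>\<delta>^O(log k)\<close>, a power of \<open>k\<close>.

  For this to work \<open>A A X\<close> has to be of size \<open>k^O(1) n\<close>. Doubling does not control triple products of
  \<open>X\<close> itself in a nonabelian group, but by an argument of Petridis it does so for some \<open>A \<subseteq> X\<close> with
  \<open>|A| \<ge> n/k\<close> (\<open>exists_subset_small_triple_product\<close>).

  The property is useful only when it returns at least two choices of \<open>u\<close>. When \<open>|X|\<close> is too small
  for that, it is at most a constant times a power of \<open>k\<close>, and a single element other than the identity suffices.
\<close>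

section \<open>Counting\<close>

lemma exists_large_fiber:
  assumes "finite Q" "finite L" "f ` Q \<subseteq> L" "Q \<noteq> {}"
  shows "\<exists>l\<in>L. card Q \<le> card L * card {q\<in>Q. f q = l}"
proof (rule ccontr)
  assume "\<not> ?thesis"
  then have less: "card L * card {q\<in>Q. f q = l} < card Q" if "l \<in> L" for l
    using that by (auto simp: not_le)
  have "L \<noteq> {}"
    using assms by auto
  have "card Q = (\<Sum>l\<in>L. card {q\<in>Q. f q = l})"
    using sum.group[OF assms(1,2,3), of "\<lambda>_. 1::nat"] by simp
  then have "card L * card Q = (\<Sum>l\<in>L. card L * card {q\<in>Q. f q = l})"
    by (simp add: sum_distrib_left)
  also have "\<dots> < (\<Sum>l\<in>L. card Q)"
    using less \<open>L \<noteq> {}\<close> assms(2) by (intro sum_strict_mono) auto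
  finally show False
    by simp
qed

lemma ratio_minimizer:
  fixes f :: "'a set \<Rightarrow> nat"
  assumes "finite X" "X \<noteq> {}"
  shows "\<exists>A\<subseteq>X. A \<noteq> {} \<and> (\<forall>D\<subseteq>X. D \<noteq> {} \<longrightarrow> f A * card D \<le> f D * card A)"
proof -
  define F where "F = Pow X - {{}}"
  define r where "r D = real (f D) / real (card D)" for D
  have F: "finite F" "F \<noteq> {}"
    using assms by (auto simp: F_def)
  obtain A where A: "A \<in> F" "\<And>D. D \<in> F \<Longrightarrow> r A \<le> r D"
    using arg_min_if_finite[OF F, of r] by (metis not_le)
  have "f A * card D \<le> f D * card A" if "D \<subseteq> X" "D \<noteq> {}" for D
  proof -
    have "card D > 0" "card A > 0"
      using that A(1) assms(1) by (auto simp: F_def card_gt_0_iff intro: finite_subset)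
    moreover have "r A \<le> r D"
      using A(2) that by (auto simp: F_def)
    ultimately have "real (f A) * real (card D) \<le> real (f D) * real (card A)"
      by (simp add: r_def field_simps)
    then show ?thesis
      by (metis of_nat_le_iff of_nat_mult)
  qed
  then show ?thesis
    using A(1) by (auto simp: F_def)
qed

section \<open>Sets of small doubling\<close>

context group
begin

lemma finite_set_mult: "finite A \<Longrightarrow> finite B \<Longrightarrow> finite (A <#> B)"
  by (auto simp: set_mult_def)

lemma card_left_translate:
  assumes "c \<in> carrier G" "D \<subseteq> carrier G"
  shows "card ((\<lambda>d. c \<otimes> d) ` D) = card D"
  by (rule card_image) (use assms in \<open>auto simp: inj_on_def subset_iff\<close>)

text \<open>The induction adds one element \<open>c\<close> to \<open>C\<close>. The points of \<open>c A X\<close> that are new come from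
  \<open>A X - D X\<close>, where \<open>D\<close> consists of the \<open>a\<close> for which \<open>c a X\<close> is already covered. Minimality of the ratio
  \<open>|A X| / |A|\<close>, applied to \<open>D\<close>, bounds their number by this ratio times \<open>|A - D|\<close>, and \<open>C A\<close> grows
  by at least \<open>|A - D|\<close>.\<close>

lemma Petridis_inequality:
  assumes X: "X \<subseteq> carrier G" "finite X" and A: "A \<subseteq> carrier G" "finite A"
    and min: "\<And>D. D \<subseteq> A \<Longrightarrow> D \<noteq> {} \<Longrightarrow> card (A <#> X) * card D \<le> card (D <#> X) * card A"
    and C: "finite C" "C \<subseteq> carrier G"
  shows "card (C <#> A <#> X) * card A \<le> card (A <#> X) * card (C <#> A)"
  using C
proof (induction C)
  case empty
  show ?case
    by (simp add: set_mult_def)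
next
  case (insert c C)
  define CA where "CA = C <#> A"
  define D where "D = {a\<in>A. \<forall>x\<in>X. c \<otimes> a \<otimes> x \<in> CA <#> X}"
  have c: "c \<in> carrier G" "C \<subseteq> carrier G" "finite C"
    using insert by auto
  have fin: "finite A" "finite CA" "finite D"
    using A X c by (auto simp: CA_def D_def intro!: finite_set_mult)
  have sub: "A \<subseteq> carrier G" "D \<subseteq> A" "CA \<subseteq> carrier G"
    using A X c by (auto simp: D_def CA_def set_mult_def)
  have finX: "finite (CA <#> X)" "finite (A <#> X)" "finite (D <#> X)"
    using fin X by (auto intro: finite_set_mult)
  have DX: "D <#> X \<subseteq> A <#> X"
    using sub by (auto simp: set_mult_def)
  have AXc: "A <#> X \<subseteq> carrier G"
    using sub X by (auto simp: set_mult_def)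
  have "insert c C <#> A <#> X \<subseteq> (CA <#> X) \<union> (\<lambda>d. c \<otimes> d) ` ((A <#> X) - (D <#> X))"
  proof
    fix g assume "g \<in> insert c C <#> A <#> X"
    then obtain b a x where g: "b \<in> insert c C" "a \<in> A" "x \<in> X" "g = b \<otimes> a \<otimes> x"
      by (auto simp: set_mult_def)
    show "g \<in> (CA <#> X) \<union> (\<lambda>d. c \<otimes> d) ` ((A <#> X) - (D <#> X))"
    proof (cases "g \<in> CA <#> X")
      case False
      then have "b = c"
        using g by (auto simp: CA_def set_mult_def)
      have ax: "a \<in> carrier G" "x \<in> carrier G"
        using g sub X by auto
      have eq: "g = c \<otimes> (a \<otimes> x)"
        using g \<open>b = c\<close> ax c by (simp add: m_assoc)
      have "a \<otimes> x \<notin> D <#> X"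
      proof
        assume "a \<otimes> x \<in> D <#> X"
        then obtain d y where "d \<in> D" "y \<in> X" "a \<otimes> x = d \<otimes> y"
          by (auto simp: set_mult_def)
        moreover from this have "c \<otimes> (d \<otimes> y) = c \<otimes> d \<otimes> y"
          using c sub X by (subst m_assoc) auto
        ultimately show False
          using False eq by (auto simp: D_def)
      qed
      moreover have "a \<otimes> x \<in> A <#> X"
        using g by (auto simp: set_mult_def)
      ultimately show ?thesis
        using eq by auto
    qed auto
  qed
  then have "card (insert c C <#> A <#> X)
      \<le> card ((CA <#> X) \<union> (\<lambda>d. c \<otimes> d) ` ((A <#> X) - (D <#> X)))"
    using finX by (intro card_mono) auto
  also have "\<dots> \<le> card (CA <#> X) + card ((\<lambda>d. c \<otimes> d) ` ((A <#> X) - (D <#> X)))"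
    by (rule card_Un_le)
  also have "\<dots> = card (CA <#> X) + (card (A <#> X) - card (D <#> X))"
    using card_left_translate[OF c(1), of "(A <#> X) - (D <#> X)"] AXc card_Diff_subset[OF finX(3) DX]
    by auto
  finally have "card (insert c C <#> A <#> X) + card (D <#> X) \<le> card (CA <#> X) + card (A <#> X)"
    using card_mono[OF finX(2) DX] by linarith
  then have upper: "(card (insert c C <#> A <#> X) + card (D <#> X)) * card A
      \<le> (card (CA <#> X) + card (A <#> X)) * card A"
    by (rule mult_le_mono1)
  have D: "card (A <#> X) * card D \<le> card (D <#> X) * card A"
    using min[of D] sub by (cases "D = {}") auto
  have IH: "card (CA <#> X) * card A \<le> card (A <#> X) * card CA"
    using insert.IH c by (simp add: CA_def)
  \<comment> \<open>If \<open>c a\<close> lies in \<open>C A\<close>, then \<open>c a X\<close> is covered by \<open>C A X\<close>, so \<open>a \<in> D\<close>.\<close>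
  have disj: "CA \<inter> (\<lambda>d. c \<otimes> d) ` (A - D) = {}"
    by (auto simp: D_def) (auto simp: set_mult_def)
  have "card CA + (card A - card D) = card (CA \<union> (\<lambda>d. c \<otimes> d) ` (A - D))"
    using disj fin sub card_left_translate[OF c(1), of "A - D"]
    by (subst card_Un_disjoint) (auto simp: card_Diff_subset subset_iff)
  also have "\<dots> \<le> card (insert c C <#> A)"
    using fin c by (intro card_mono finite_set_mult) (auto simp: CA_def set_mult_def)
  finally have "card CA + card A \<le> card (insert c C <#> A) + card D"
    by linarith
  then have "card (A <#> X) * (card CA + card A) \<le> card (A <#> X) * (card (insert c C <#> A) + card D)"
    by (rule mult_le_mono2)
  then show ?case
    using upper D IH by (simp add: algebra_simps)
qed

text \<open>With \<open>k = |X X| / |X|\<close>, the two bounds say \<open>|A| \<ge> |X| / k\<close> and \<open>|A A X| \<le> k\<^sup>2 |X|\<close>. The set \<open>A\<close>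
  minimizes \<open>|A X| / |A|\<close>, which is then at most \<open>k\<close>. Since \<open>|A X| \<ge> |X|\<close>, this keeps \<open>A\<close> from being
  small; Petridis' inequality with \<open>C = A\<close> bounds \<open>|A A X|\<close>.\<close>

lemma exists_subset_small_triple_product:
  assumes X: "X \<subseteq> carrier G" "finite X" "X \<noteq> {}"
  shows "\<exists>A\<subseteq>X. card X * card X \<le> card (X <#> X) * card A \<and>
           card (A <#> A <#> X) * card X \<le> card (X <#> X) * card (X <#> X)"
proof -
  obtain A where A: "A \<subseteq> X" "A \<noteq> {}"
    and min: "\<And>D. D \<subseteq> X \<Longrightarrow> D \<noteq> {} \<Longrightarrow> card (A <#> X) * card D \<le> card (D <#> X) * card A"
    using ratio_minimizer[OF X(2,3), of "\<lambda>D. card (D <#> X)"] by blast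
  have finA: "finite A" "card A > 0" "A \<subseteq> carrier G"
    using A X by (auto simp: card_gt_0_iff intro: finite_subset)
  have X_ratio: "card (A <#> X) * card X \<le> card (X <#> X) * card A"
    using min[of X] X by auto
  obtain a where a: "a \<in> A"
    using A by auto
  have "card X = card ((\<lambda>x. a \<otimes> x) ` X)"
    using card_left_translate[of a X] a finA X by auto
  also have "\<dots> \<le> card (A <#> X)"
    using finA X a by (intro card_mono finite_set_mult) (auto simp: set_mult_def)
  finally have 1: "card X * card X \<le> card (X <#> X) * card A"
    using X_ratio by (meson le_trans mult_le_mono1)
  have "card (A <#> A <#> X) * card A \<le> card (A <#> X) * card (A <#> A)"
    using Petridis_inequality[OF X(1,2) finA(3,1) _ finA(1,3)] min A by blast
  also have "card (A <#> A) \<le> card (X <#> X)"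
    using A X by (intro card_mono finite_set_mult) (auto simp: set_mult_def)
  finally have "card (A <#> A <#> X) * card A \<le> card (A <#> X) * card (X <#> X)"
    by simp
  then have "card (A <#> A <#> X) * card A * card X \<le> card (A <#> X) * card (X <#> X) * card X"
    by (rule mult_le_mono1)
  also have "\<dots> = card (A <#> X) * card X * card (X <#> X)"
    by simp
  also have "\<dots> \<le> card (X <#> X) * card A * card (X <#> X)"
    using X_ratio by (rule mult_le_mono1)
  finally have "card A * (card (A <#> A <#> X) * card X) \<le> card A * (card (X <#> X) * card (X <#> X))"
    by (simp add: ac_simps)
  then have 2: "card (A <#> A <#> X) * card X \<le> card (X <#> X) * card (X <#> X)"
    using finA by simp
  show ?thesis
    using A(1) 1 2 by blast
qed

text \<open>An instance of Ruzsa's triangle inequality: with a representation \<open>d = a\<inverse> b\<close> fixed for every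
  quotient \<open>d\<close>, the pair \<open>(x a, x b)\<close> determines \<open>d = (x a)\<inverse> (x b)\<close> and then \<open>x\<close>.\<close>

lemma card_quotient_set:
  assumes X: "X \<subseteq> carrier G" "finite X"
  shows "card ((\<lambda>(a, b). inv a \<otimes> b) ` (X \<times> X)) * card X \<le> card (X <#> X) * card (X <#> X)"
proof -
  define E where "E = (\<lambda>(a, b). inv a \<otimes> b) ` (X \<times> X)"
  have "\<forall>d\<in>E. \<exists>p\<in>X \<times> X. d = inv (fst p) \<otimes> snd p"
    by (auto simp: E_def)
  then obtain p where p: "\<And>d. d \<in> E \<Longrightarrow> p d \<in> X \<times> X \<and> d = inv (fst (p d)) \<otimes> snd (p d)"
    by metis
  define \<phi> where "\<phi> = (\<lambda>(d, x). (x \<otimes> fst (p d), x \<otimes> snd (p d)))"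
  have quot: "d = inv (x \<otimes> fst (p d)) \<otimes> (x \<otimes> snd (p d))" if "d \<in> E" "x \<in> X" for d x
  proof -
    have "fst (p d) \<in> carrier G" "snd (p d) \<in> carrier G" "x \<in> carrier G"
      using p[OF that(1)] that X by auto
    then have "inv (x \<otimes> fst (p d)) \<otimes> (x \<otimes> snd (p d)) = inv (fst (p d)) \<otimes> snd (p d)"
      by (simp add: inv_mult_group m_assoc inv_solve_left')
    then show ?thesis
      using p[OF that(1)] by simp
  qed
  have "inj_on \<phi> (E \<times> X)"
  proof (rule inj_onI, clarify)
    fix d x e y assume *: "d \<in> E" "x \<in> X" "e \<in> E" "y \<in> X" "\<phi> (d, x) = \<phi> (e, y)"
    then have "d = e"
      using quot[of d x] quot[of e y] by (simp add: \<phi>_def)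
    moreover have "fst (p d) \<in> carrier G"
      using p[of d] * X by auto
    ultimately show "d = e \<and> x = y"
      using * X by (auto simp: \<phi>_def subset_iff)
  qed
  moreover have "\<phi> ` (E \<times> X) \<subseteq> (X <#> X) \<times> (X <#> X)"
    using p by (fastforce simp: \<phi>_def set_mult_def)
  ultimately have "card (E \<times> X) \<le> card ((X <#> X) \<times> (X <#> X))"
    using X by (intro card_inj_on_le) (auto intro: finite_set_mult)
  then show ?thesis
    by (simp add: card_cartesian_product E_def)
qed

section \<open>Product-free sets from a solution-free triple\<close>

definition triples_into :: "'a set \<Rightarrow> 'a set \<Rightarrow> 'a set \<Rightarrow> 'a set \<Rightarrow> ('a \<times> 'a \<times> 'a) set" where
  "triples_into A U V Z = {(x, u, v). x \<in> A \<and> u \<in> U \<and> v \<in> V \<and> x \<otimes> u \<otimes> v \<in> Z}"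

lemma finite_triples_into:
  "finite A \<Longrightarrow> finite U \<Longrightarrow> finite V \<Longrightarrow> finite (triples_into A U V Z)"
  by (rule finite_subset[of _ "A \<times> U \<times> V"]) (auto simp: triples_into_def)

text \<open>Two applications of the pigeonhole principle: the triples are first sorted by \<open>l = u v\<close>, and
  those over \<open>l\<close> inject into \<open>Y \<times> N\<close> by forgetting \<open>v\<close>; the pairs \<open>(y, n)\<close> are then sorted by
  \<open>t = n\<inverse> y\<close>, and those over \<open>t\<close> inject into \<open>Y \<inter> N t\<close>. The losses are \<open>|X X|\<close> and \<open>|X\<inverse> X|\<close>, and
  \<open>|X\<inverse> X| |X| \<le> |X X|\<^sup>2\<close>.\<close>

lemma product_free_from_solution_free:
  assumes X: "X \<subseteq> carrier G" "finite X" and sub: "A \<subseteq> X" "U \<subseteq> X" "V \<subseteq> X"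
    and free: "\<And>u v. u \<in> U \<Longrightarrow> v \<in> V \<Longrightarrow> u \<otimes> v \<notin> Z"
  shows "\<exists>S\<subseteq>X. product_free G S \<and>
           card (triples_into A U V Z) * card X \<le> card (X <#> X) ^ 3 * card S"
proof (cases "triples_into A U V Z = {}")
  case True
  then show ?thesis
    by (intro exI[of _ "{}"]) (auto simp: product_free_def)
next
  case False
  have fin: "finite A" "finite U" "finite V"
    using sub X(2) by (auto intro: finite_subset)
  have car: "A \<subseteq> carrier G" "U \<subseteq> carrier G" "V \<subseteq> carrier G"
    using sub X by auto
  define Q where "Q = triples_into A U V Z"
  have finQ: "finite Q"
    unfolding Q_def using fin by (rule finite_triples_into)
  have "(\<lambda>(x, u, v). u \<otimes> v) ` Q \<subseteq> X <#> X"
    using sub by (fastforce simp: Q_def triples_into_def set_mult_def)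
  then obtain l where l: "l \<in> X <#> X"
    "card Q \<le> card (X <#> X) * card {q\<in>Q. (\<lambda>(x, u, v). u \<otimes> v) q = l}"
    using exists_large_fiber[OF finQ finite_set_mult[OF X(2) X(2)]] False Q_def by blast
  have lc: "l \<in> carrier G"
    using l X by (auto simp: set_mult_def)
  define N where "N = {u\<in>U. \<exists>v\<in>V. u \<otimes> v = l}"
  define Y where "Y = {x\<in>A. x \<otimes> l \<in> Z}"
  have finNY: "finite N" "finite Y"
    using fin by (auto simp: N_def Y_def)
  have "card {q\<in>Q. (\<lambda>(x, u, v). u \<otimes> v) q = l} \<le> card (Y \<times> N)"
  proof (rule card_inj_on_le[of "\<lambda>(x, u, v). (x, u)"])
    show "inj_on (\<lambda>(x, u, v). (x, u)) {q\<in>Q. (\<lambda>(x, u, v). u \<otimes> v) q = l}"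
    proof (rule inj_onI, clarsimp simp: Q_def triples_into_def)
      fix u v w
      assume "u \<in> U" "v \<in> V" "w \<in> V" "u \<otimes> w = u \<otimes> v"
      then show "v = w"
        using car by (simp add: subset_iff)
    qed
    have "x \<otimes> (u \<otimes> v) \<in> Z" if "(x, u, v) \<in> Q" for x u v
      using that car m_assoc[of x u v] by (auto simp: Q_def triples_into_def subset_iff)
    then show "(\<lambda>(x, u, v). (x, u)) ` {q\<in>Q. (\<lambda>(x, u, v). u \<otimes> v) q = l} \<subseteq> Y \<times> N"
      by (auto simp: Y_def N_def) (auto simp: Q_def triples_into_def)
  qed (use finNY in auto)
  then have Q: "card Q \<le> card (X <#> X) * card (Y \<times> N)"
    using l(2) by (meson le_trans mult_le_mono2)
  then have "Y \<times> N \<noteq> {}"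
    using False finQ Q_def by (metis card.empty card_gt_0_iff mult_0_right not_le)
  define E where "E = (\<lambda>(a, b). inv a \<otimes> b) ` (X \<times> X)"
  have "(\<lambda>(y, n). inv n \<otimes> y) ` (Y \<times> N) \<subseteq> E"
    using sub by (auto simp: E_def Y_def N_def image_def)
  then obtain t where t: "t \<in> E"
    "card (Y \<times> N) \<le> card E * card {q\<in>Y \<times> N. (\<lambda>(y, n). inv n \<otimes> y) q = t}"
    using exists_large_fiber[of "Y \<times> N" E "\<lambda>(y, n). inv n \<otimes> y"] \<open>Y \<times> N \<noteq> {}\<close> finNY X(2) E_def
    by blast
  have tc: "t \<in> carrier G"
    using t X by (auto simp: E_def)
  define S where "S = {y\<in>Y. \<exists>n\<in>N. y = n \<otimes> t}"
  have eq: "y = n \<otimes> t" if "y \<in> Y" "n \<in> N" "inv n \<otimes> y = t" for y n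
  proof -
    have "y \<in> carrier G" "n \<in> carrier G"
      using that car by (auto simp: Y_def N_def)
    then show ?thesis
      using that(3) by (auto simp flip: m_assoc)
  qed
  have "card {q\<in>Y \<times> N. (\<lambda>(y, n). inv n \<otimes> y) q = t} \<le> card S"
  proof (rule card_inj_on_le[of fst])
    show "inj_on fst {q\<in>Y \<times> N. (\<lambda>(y, n). inv n \<otimes> y) q = t}"
    proof (rule inj_onI, clarsimp)
      fix y n m
      assume "y \<in> Y" "n \<in> N" "m \<in> N" "inv m \<otimes> y = inv n \<otimes> y"
      then show "n = m"
        using car by (simp add: Y_def N_def subset_iff)
          (metis inv_closed inv_inv right_cancel)
    qed
    show "fst ` {q\<in>Y \<times> N. (\<lambda>(y, n). inv n \<otimes> y) q = t} \<subseteq> S"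
      using eq by (fastforce simp: S_def)
  qed (use finNY in \<open>auto simp: S_def\<close>)
  then have "card (Y \<times> N) \<le> card E * card S"
    using t(2) by (meson le_trans mult_le_mono2)
  then have "card Q * card X \<le> card (X <#> X) * (card E * card S) * card X"
    using Q by (meson le_trans mult_le_mono1 mult_le_mono2)
  also have "\<dots> = (card E * card X) * (card (X <#> X) * card S)"
    by simp
  also have "\<dots> \<le> (card (X <#> X) * card (X <#> X)) * (card (X <#> X) * card S)"
    using card_quotient_set[OF X] unfolding E_def by (rule mult_le_mono1)
  finally have card: "card Q * card X \<le> card (X <#> X) ^ 3 * card S"
    by (simp add: power3_eq_cube ac_simps)
  have "product_free G S"
    unfolding product_free_def
  proof (intro conjI ballI notI)
    show "S \<subseteq> carrier G"
      using car by (auto simp: S_def Y_def)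
    fix a b assume "a \<in> S" "b \<in> S" "a \<otimes> b \<in> S"
    then obtain m n where mn: "m \<in> N" "n \<in> N" "a \<in> Y" "b = m \<otimes> t" "a \<otimes> b = n \<otimes> t"
      by (auto simp: S_def)
    obtain v where v: "v \<in> V" "m \<otimes> v = l"
      using mn by (auto simp: N_def)
    have in_car: "a \<in> carrier G" "m \<in> carrier G" "n \<in> carrier G" "v \<in> carrier G"
      using mn v car by (auto simp: Y_def N_def)
    \<comment> \<open>Here \<open>a = n m\<inverse>\<close> with \<open>n, m \<in> N\<close>, so that \<open>a l = n v\<close> lies in both \<open>U V\<close> and \<open>Z\<close>.\<close>
    have "a \<otimes> m \<otimes> t = n \<otimes> t"
      using mn in_car tc by (simp add: m_assoc)
    then have "a \<otimes> m = n"
      using in_car tc by simp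
    then have "a \<otimes> l = n \<otimes> v"
      using v(2) in_car by (metis m_assoc)
    then show False
      using free[of n v] mn v by (simp add: Y_def N_def)
  qed
  moreover have "S \<subseteq> X"
    using sub by (auto simp: S_def Y_def)
  ultimately show ?thesis
    using card Q_def by blast
qed

section \<open>Popular products\<close>

definition popular :: "'a set \<Rightarrow> 'a set \<Rightarrow> 'a set \<Rightarrow> real \<Rightarrow> 'a set" where
  "popular A U V \<tau> = {z. \<tau> \<le> real (card (triples_into A U V {z}))}"

lemma popular_subset: "0 < \<tau> \<Longrightarrow> popular A U V \<tau> \<subseteq> A <#> U <#> V"
proof
  fix z assume "0 < \<tau>" "z \<in> popular A U V \<tau>"
  then have "triples_into A U V {z} \<noteq> {}"
    by (auto simp: popular_def)
  then show "z \<in> A <#> U <#> V"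
    by (auto simp: triples_into_def set_mult_def)
qed

lemma popular_mono:
  assumes "finite A" "finite U" "finite V" "U' \<subseteq> U" "V' \<subseteq> V"
  shows "popular A U' V' \<tau> \<subseteq> popular A U V \<tau>"
proof
  fix z assume z: "z \<in> popular A U' V' \<tau>"
  have "card (triples_into A U' V' {z}) \<le> card (triples_into A U V {z})"
    using assms by (intro card_mono finite_triples_into) (auto simp: triples_into_def)
  then show "z \<in> popular A U V \<tau>"
    using z by (simp add: popular_def)
qed

lemma card_triples_into:
  assumes "finite A" "finite U" "finite V" "finite Z"
  shows "card (triples_into A U V Z) = (\<Sum>z\<in>Z. card (triples_into A U V {z}))"
proof -
  have "triples_into A U V Z = (\<Union>z\<in>Z. triples_into A U V {z})"
    by (auto simp: triples_into_def)
  moreover have "card (\<Union>z\<in>Z. triples_into A U V {z}) = (\<Sum>z\<in>Z. card (triples_into A U V {z}))"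
  proof (rule card_UN_disjoint[OF assms(4)])
    show "\<forall>z\<in>Z. finite (triples_into A U V {z})"
      using finite_triples_into[OF assms(1-3)] by blast
  qed (auto simp: triples_into_def)
  ultimately show ?thesis
    by simp
qed

lemma card_triples_into_singleton_le:
  assumes "A \<subseteq> carrier G" "U \<subseteq> carrier G" "V \<subseteq> carrier G" "finite U" "finite V"
  shows "card (triples_into A U V {z}) \<le> card U * card V"
proof -
  have "card (triples_into A U V {z}) \<le> card (U \<times> V)"
  proof (rule card_inj_on_le[of snd])
    show "inj_on snd (triples_into A U V {z})"
    proof (rule inj_onI)
      fix p q assume pq: "p \<in> triples_into A U V {z}" "q \<in> triples_into A U V {z}" "snd p = snd q"
      obtain x y u v where p: "p = (x, u, v)" and q: "q = (y, u, v)"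
        using pq(3) by (metis prod.collapse)
      then have "x \<in> carrier G" "y \<in> carrier G" "u \<in> carrier G" "v \<in> carrier G"
        "x \<otimes> u \<otimes> v = y \<otimes> u \<otimes> v"
        using pq(1,2) assms by (auto simp: triples_into_def)
      then show "p = q"
        using p q by simp
    qed
  qed (use assms in \<open>auto simp: triples_into_def\<close>)
  then show ?thesis
    by (simp add: card_cartesian_product)
qed

lemma card_triples_into_popular:
  assumes "finite A" "finite U" "finite V" "finite Z" "Z \<subseteq> popular A U V \<tau>"
  shows "real (card Z) * \<tau> \<le> real (card (triples_into A U V Z))"
proof -
  have "real (card Z) * \<tau> \<le> (\<Sum>z\<in>Z. real (card (triples_into A U V {z})))"
    using assms(5) by (intro sum_bounded_below) (auto simp: popular_def)
  then show ?thesis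
    using card_triples_into[OF assms(1-4)] by simp
qed

text \<open>Unpopular products account for at most half of the \<open>|A| |U| |V|\<close> triples, and every product
  for at most \<open>|U| |V|\<close> of them, since \<open>u\<close> and \<open>v\<close> determine \<open>x\<close>.\<close>

lemma card_popular_ge:
  assumes car: "A \<subseteq> carrier G" "U \<subseteq> carrier G" "V \<subseteq> carrier G"
    and fin: "finite A" "finite U" "finite V" and ne: "U \<noteq> {}" "V \<noteq> {}"
    and \<tau>: "0 < \<tau>" "2 * \<tau> * real (card (A <#> U <#> V)) \<le> real (card A) * real (card U) * real (card V)"
  shows "real (card A) \<le> 2 * real (card (popular A U V \<tau>))"
proof -
  define W where "W = A <#> U <#> V"
  define P where "P = popular A U V \<tau>"
  define r where "r z = real (card (triples_into A U V {z}))" for z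
  have finW: "finite W"
    using fin by (auto simp: W_def intro!: finite_set_mult)
  have P: "P \<subseteq> W"
    using popular_subset[OF \<tau>(1)] by (simp add: P_def W_def)
  have "triples_into A U V W = A \<times> U \<times> V"
    by (auto simp: triples_into_def W_def set_mult_def)
  then have "real (card A) * real (card U) * real (card V) = (\<Sum>z\<in>W. r z)"
    using card_triples_into[OF fin finW] by (simp add: r_def card_cartesian_product flip: of_nat_sum of_nat_mult)
  also have "\<dots> = (\<Sum>z\<in>W - P. r z) + (\<Sum>z\<in>P. r z)"
    using P finW by (rule sum.subset_diff)
  also have "(\<Sum>z\<in>W - P. r z) \<le> real (card (W - P)) * \<tau>"
    by (rule sum_bounded_above) (auto simp: P_def popular_def r_def)
  also have "\<dots> \<le> real (card W) * \<tau>"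
    using finW \<tau> by (intro mult_right_mono) (auto intro!: card_mono)
  also have "(\<Sum>z\<in>P. r z) \<le> real (card P) * (real (card U) * real (card V))"
    using card_triples_into_singleton_le[OF car fin(2,3)]
    by (intro sum_bounded_above) (auto simp: r_def simp flip: of_nat_mult)
  finally have "real (card A) * (real (card U) * real (card V))
      \<le> 2 * real (card P) * (real (card U) * real (card V))"
    using \<tau>(2) by (simp add: W_def algebra_simps)
  moreover have "real (card U) * real (card V) > 0"
    using fin ne by (simp add: card_gt_0_iff)
  ultimately show ?thesis
    unfolding P_def by (rule mult_right_le_imp_le)
qed

section \<open>Iterating the Erdos-Hajnal property\<close>

definition product_Erdos_Hajnal :: "real \<Rightarrow> bool" where
  "product_Erdos_Hajnal \<delta> \<longleftrightarrow>
     (\<forall>A B C. A \<subseteq> carrier G \<and> B \<subseteq> carrier G \<and> C \<subseteq> carrier G \<and> finite A \<and> finite B \<and> finite C \<longrightarrow>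
       (\<exists>A'\<subseteq>A. \<exists>B'\<subseteq>B. \<exists>C'\<subseteq>C.
          \<delta> * real (card A) \<le> real (card A') \<and> \<delta> * real (card B) \<le> real (card B') \<and>
          \<delta> * real (card C) \<le> real (card C') \<and>
          ((\<forall>a\<in>A'. \<forall>b\<in>B'. \<forall>c\<in>C'. a \<otimes> b = c) \<or> (\<forall>a\<in>A'. \<forall>b\<in>B'. \<forall>c\<in>C'. a \<otimes> b \<noteq> c))))"

text \<open>The other kind of homogeneity, \<open>u v = z\<close> throughout, cannot occur with all three sets
  nonempty: it would force \<open>u = z v\<inverse>\<close> for fixed \<open>v\<close>, \<open>z\<close>, whereas \<open>U'\<close> has more than one element.\<close>

lemma solution_free_subsets:
  assumes EH: "product_Erdos_Hajnal \<delta>" and \<delta>: "0 < \<delta>"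
    and car: "U \<subseteq> carrier G" "V \<subseteq> carrier G" "P \<subseteq> carrier G"
    and fin: "finite U" "finite V" "finite P"
    and U: "1 < \<delta> * real (card U)" and V: "V \<noteq> {}"
  shows "\<exists>U'\<subseteq>U. \<exists>V'\<subseteq>V. \<exists>Z\<subseteq>P. \<delta> * real (card U) \<le> real (card U') \<and>
           \<delta> * real (card V) \<le> real (card V') \<and> \<delta> * real (card P) \<le> real (card Z) \<and>
           (\<forall>u\<in>U'. \<forall>v\<in>V'. u \<otimes> v \<notin> Z)"
proof -
  obtain U' V' Z where sub: "U' \<subseteq> U" "V' \<subseteq> V" "Z \<subseteq> P"
    and card: "\<delta> * real (card U) \<le> real (card U')" "\<delta> * real (card V) \<le> real (card V')"
      "\<delta> * real (card P) \<le> real (card Z)"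
    and hom: "(\<forall>a\<in>U'. \<forall>b\<in>V'. \<forall>c\<in>Z. a \<otimes> b = c) \<or> (\<forall>a\<in>U'. \<forall>b\<in>V'. \<forall>c\<in>Z. a \<otimes> b \<noteq> c)"
    using EH[unfolded product_Erdos_Hajnal_def, rule_format, of U V P] car fin by metis
  have "\<forall>u\<in>U'. \<forall>v\<in>V'. u \<otimes> v \<notin> Z"
    using hom
  proof
    assume all: "\<forall>a\<in>U'. \<forall>b\<in>V'. \<forall>c\<in>Z. a \<otimes> b = c"
    have "0 < \<delta> * real (card V)"
      using V fin \<delta> by (simp add: card_gt_0_iff)
    then have "V' \<noteq> {}"
      using card(2) by auto
    then obtain b where b: "b \<in> V'" "b \<in> carrier G"
      using sub car by blast
    have "Z = {}"
    proof (rule ccontr)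
      assume "Z \<noteq> {}"
      then obtain z where "z \<in> Z"
        by blast
      have "a = z \<otimes> inv b" if "a \<in> U'" for a
      proof -
        have "a \<otimes> b = z" "a \<in> carrier G"
          using all that b \<open>z \<in> Z\<close> sub car by auto
        then show ?thesis
          using b by (auto simp: m_assoc)
      qed
      then have "U' \<subseteq> {z \<otimes> inv b}"
        by blast
      then have "card U' \<le> 1"
        using card_mono[of "{z \<otimes> inv b}" U'] by simp
      then show False
        using card(1) U by simp
    qed
    then show ?thesis
      by simp
  qed blast
  then show ?thesis
    using sub card by blast
qed

lemma product_free_or_fewer_popular:
  assumes EH: "product_Erdos_Hajnal \<delta>" and \<delta>: "0 < \<delta>"
    and X: "X \<subseteq> carrier G" "finite X" and sub: "A \<subseteq> X" "U \<subseteq> X" "V \<subseteq> X"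
    and U: "1 < \<delta> * real (card U)" and V: "V \<noteq> {}" and \<tau>: "0 < \<tau>"
  shows "(\<exists>S\<subseteq>X. product_free G S \<and>
            \<delta> / 2 * real (card (popular A U V \<tau>)) * \<tau> * real (card X) \<le> real (card (X <#> X)) ^ 3 * real (card S)) \<or>
         (\<exists>U'\<subseteq>U. \<exists>V'\<subseteq>V. \<delta> * real (card U) \<le> real (card U') \<and> \<delta> * real (card V) \<le> real (card V') \<and>
            real (card (popular A U' V' \<tau>)) \<le> (1 - \<delta> / 2) * real (card (popular A U V \<tau>)))"
proof -
  define P where "P = popular A U V \<tau>"
  have fin: "finite A" "finite U" "finite V"
    using sub X(2) by (auto intro: finite_subset)
  have car: "A \<subseteq> carrier G" "U \<subseteq> carrier G" "V \<subseteq> carrier G"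
    using sub X by auto
  have AUV: "P \<subseteq> A <#> U <#> V"
    using popular_subset[OF \<tau>] by (simp add: P_def)
  have finP: "finite P"
    using AUV fin by (meson finite_subset finite_set_mult)
  have P: "P \<subseteq> carrier G"
    using AUV car set_mult_closed by (meson subset_trans)
  obtain U' V' Z where sub': "U' \<subseteq> U" "V' \<subseteq> V" "Z \<subseteq> P"
    and card: "\<delta> * real (card U) \<le> real (card U')" "\<delta> * real (card V) \<le> real (card V')"
      "\<delta> * real (card P) \<le> real (card Z)"
    and free: "\<And>u v. u \<in> U' \<Longrightarrow> v \<in> V' \<Longrightarrow> u \<otimes> v \<notin> Z"
    using solution_free_subsets[OF EH \<delta> car(2,3) P fin(2,3) finP U V] by metis
  define P' where "P' = popular A U' V' \<tau>"
  have P': "P' \<subseteq> P"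
    unfolding P_def P'_def using fin sub' by (intro popular_mono) auto
  have finZ: "finite Z" "finite (Z \<inter> P')" "finite P'"
    using sub' finP P' by (auto intro: finite_subset)
  have fin': "finite U'" "finite V'"
    using sub' fin by (auto intro: finite_subset)
  show ?thesis
  proof (cases "real (card (Z \<inter> P')) \<le> \<delta> / 2 * real (card P)")
    case True
    \<comment> \<open>\<open>P'\<close> and \<open>Z\<close> lie in \<open>P\<close>, and at most half of \<open>Z\<close> survives in \<open>P'\<close>.\<close>
    have "card P' + card Z = card (P' \<union> Z) + card (P' \<inter> Z)"
      using finZ(3,1) by (rule card_Un_Int)
    moreover have "card (P' \<union> Z) \<le> card P"
      using P' sub' finP by (intro card_mono) auto
    ultimately have "card P' + card Z \<le> card P + card (Z \<inter> P')"
      unfolding Int_commute[of P'] by linarith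
    then have "real (card P') + real (card Z) \<le> real (card P) + real (card (Z \<inter> P'))"
      by linarith
    then have "real (card P') \<le> (1 - \<delta> / 2) * real (card P)"
      using True card(3) by (simp add: algebra_simps)
    then show ?thesis
      using sub' card by (auto simp: P_def P'_def)
  next
    case False
    have "U' \<subseteq> X" "V' \<subseteq> X" "\<And>u v. u \<in> U' \<Longrightarrow> v \<in> V' \<Longrightarrow> u \<otimes> v \<notin> Z \<inter> P'"
      using sub sub' free by auto
    from product_free_from_solution_free[OF X sub(1) this]
    obtain S where S: "S \<subseteq> X" "product_free G S"
      "card (triples_into A U' V' (Z \<inter> P')) * card X \<le> card (X <#> X) ^ 3 * card S"
      by auto
    have "\<delta> / 2 * real (card P) * \<tau> * real (card X) \<le> real (card (Z \<inter> P')) * \<tau> * real (card X)"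
      using False \<tau> by (intro mult_right_mono) auto
    also have "\<dots> \<le> real (card (triples_into A U' V' (Z \<inter> P'))) * real (card X)"
      using fin fin' finZ by (intro mult_right_mono card_triples_into_popular) (auto simp: P'_def)
    also have "\<dots> \<le> real (card (X <#> X)) ^ 3 * real (card S)"
      using S(3) by (simp flip: of_nat_mult of_nat_power)
    finally show ?thesis
      using S by (auto simp: P_def)
  qed
qed

text \<open>\<open>T\<close> bounds the number of steps. If none of them produced the product-free set, the popular set
  would shrink from \<open>k\<^sup>2 n\<close> to less than \<open>n / (2 k)\<close>, its guaranteed size; this is what \<open>T\<close> is chosen for.
  The largeness condition ensures that \<open>U\<close> can be subdivided once more after fewer than \<open>T\<close> steps.\<close>

lemma exists_product_free_of_many_steps:
  assumes EH: "product_Erdos_Hajnal \<delta>" and \<delta>: "0 < \<delta>" "\<delta> < 1"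
    and X: "X \<subseteq> carrier G" "finite X" "X \<noteq> {}"
    and k: "k = real (card (X <#> X)) / real (card X)"
    and T: "(1 - \<delta> / 2) ^ T * (2 * k ^ 3) < 1"
    and large: "1 < \<delta> ^ (T + 1) * real (card X) / k"
  shows "\<exists>S\<subseteq>X. product_free G S \<and> \<delta> ^ (2 * T + 1) * real (card X) / (8 * k ^ 8) \<le> real (card S)"
proof (rule ccontr)
  assume none: "\<not> ?thesis"
  define n where "n = real (card X)"
  have n: "0 < n"
    using X by (simp add: n_def card_gt_0_iff)
  obtain A where A: "A \<subseteq> X" "card X * card X \<le> card (X <#> X) * card A"
    "card (A <#> A <#> X) * card X \<le> card (X <#> X) * card (X <#> X)"
    using exists_subset_small_triple_product[OF X] by blast
  have XX: "real (card (X <#> X)) = k * n"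
    using n by (simp add: k n_def)
  have k0: "0 < k"
    using large by (cases "k = 0") (auto simp: k intro!: divide_pos_pos)
  have "n * n \<le> k * n * real (card A)"
    using of_nat_mono[OF A(2), where 'a = real] XX by (simp add: n_def)
  then have cardA: "n / k \<le> real (card A)"
    using n k0 by (simp add: field_simps)
  have "real (card (A <#> A <#> X)) * n \<le> (k * n) * (k * n)"
    using of_nat_mono[OF A(3), where 'a = real] XX by (simp add: n_def)
  then have AAX: "real (card (A <#> A <#> X)) \<le> k ^ 2 * n"
    using n by (simp add: power2_eq_square)
  \<comment> \<open>The largest threshold for which unpopular products account for at most half of the triples
    even when \<open>|U| = \<delta>^T n / k\<close> and \<open>|V| = \<delta>^T n\<close>, given \<open>|A| \<ge> n / k\<close> and \<open>|A A X| \<le> k\<^sup>2 n\<close>.\<close>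
  define \<tau> where "\<tau> = \<delta> ^ (2 * T) * n ^ 2 / (2 * k ^ 4)"
  have \<tau>: "0 < \<tau>"
    using n k0 \<delta> by (simp add: \<tau>_def)
  have finA: "finite A"
    using A X by (auto intro: finite_subset)
  have popular_ge: "n / (2 * k) \<le> real (card (popular A U V \<tau>))"
    if UV: "U \<subseteq> A" "V \<subseteq> X" "\<delta> ^ t * real (card A) \<le> real (card U)" "\<delta> ^ t * n \<le> real (card V)" "t \<le> T"
    for U V t
  proof -
    have fin: "finite U" "finite V"
      using UV finA X by (auto intro: finite_subset)
    have "0 < n / k"
      using n k0 by simp
    then have "0 < \<delta> ^ t * real (card A)" "0 < \<delta> ^ t * n"
      using \<delta> n cardA by auto
    then have ne: "U \<noteq> {}" "V \<noteq> {}"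
      using UV by auto
    have "A <#> U <#> V \<subseteq> A <#> A <#> X"
      using UV by (intro mono_set_mult) auto
    then have "card (A <#> U <#> V) \<le> card (A <#> A <#> X)"
      using finA X by (intro card_mono finite_set_mult)
    then have "real (card (A <#> U <#> V)) \<le> k ^ 2 * n"
      using AAX by linarith
    then have "2 * \<tau> * real (card (A <#> U <#> V)) \<le> 2 * \<tau> * (k ^ 2 * n)"
      using \<tau> by (intro mult_left_mono) auto
    also have "\<dots> = (n / k) * (\<delta> ^ T * (n / k)) * (\<delta> ^ T * n)"
      using k0 by (simp add: \<tau>_def field_simps power_mult power2_eq_square power4_eq_xxxx)
    also have "\<dots> \<le> real (card A) * real (card U) * real (card V)"
    proof (intro mult_mono)
      have pow: "\<delta> ^ T \<le> \<delta> ^ t"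
        using \<delta> UV by (intro power_decreasing) auto
      have "\<delta> ^ T * (n / k) \<le> \<delta> ^ t * real (card A)"
        using pow cardA \<delta> n k0 by (intro mult_mono) auto
      then show "\<delta> ^ T * (n / k) \<le> real (card U)"
        using UV by linarith
      have "\<delta> ^ T * n \<le> \<delta> ^ t * n"
        using pow n by (intro mult_right_mono) auto
      then show "\<delta> ^ T * n \<le> real (card V)"
        using UV by linarith
    qed (use cardA \<delta> n k0 in auto)
    finally have "real (card A) \<le> 2 * real (card (popular A U V \<tau>))"
      using card_popular_ge[of A U V \<tau>] \<tau> ne fin finA UV A X by auto
    then show ?thesis
      using cardA by (simp add: field_simps)
  qed
  have "\<exists>U\<subseteq>A. \<exists>V\<subseteq>X. \<delta> ^ t * real (card A) \<le> real (card U) \<and> \<delta> ^ t * n \<le> real (card V) \<and>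
      real (card (popular A U V \<tau>)) \<le> (1 - \<delta> / 2) ^ t * (k ^ 2 * n)" if "t \<le> T" for t
    using that
  proof (induction t)
    case 0
    have "card (popular A A X \<tau>) \<le> card (A <#> A <#> X)"
      using popular_subset[OF \<tau>] finA X by (intro card_mono finite_set_mult)
    then show ?case
      using AAX by (intro exI[of _ A] exI[of _ X] conjI) (auto simp: n_def)
  next
    case (Suc t)
    then obtain U V where UV: "U \<subseteq> A" "V \<subseteq> X" "\<delta> ^ t * real (card A) \<le> real (card U)"
      "\<delta> ^ t * n \<le> real (card V)" "real (card (popular A U V \<tau>)) \<le> (1 - \<delta> / 2) ^ t * (k ^ 2 * n)"
      by auto
    define p where "p = real (card (popular A U V \<tau>))"
    have p: "n / (2 * k) \<le> p"
      using popular_ge[OF UV(1-4)] Suc.prems by (simp add: p_def)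
    have "\<delta> ^ (T + 1) * (n / k) \<le> \<delta> ^ Suc t * real (card A)"
      using cardA \<delta> n k0 Suc.prems by (intro mult_mono power_decreasing) auto
    also have "\<dots> \<le> \<delta> * real (card U)"
      using UV(3) \<delta> by simp
    finally have U: "1 < \<delta> * real (card U)"
      using large by (simp add: n_def)
    have "0 < \<delta> ^ t * n"
      using \<delta> n by simp
    then have V: "V \<noteq> {}"
      using UV(4) by auto
    have "\<not> (\<exists>S\<subseteq>X. product_free G S \<and>
            \<delta> / 2 * p * \<tau> * real (card X) \<le> real (card (X <#> X)) ^ 3 * real (card S))"
    proof (intro notI, elim exE conjE)
      fix S assume S: "S \<subseteq> X" "product_free G S"
        "\<delta> / 2 * p * \<tau> * real (card X) \<le> real (card (X <#> X)) ^ 3 * real (card S)"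
      have "\<delta> / 2 * (n / (2 * k)) * \<tau> * n \<le> \<delta> / 2 * p * \<tau> * n"
        using p \<delta> \<tau> n by (intro mult_right_mono mult_left_mono) auto
      also have "\<dots> \<le> (k * n) ^ 3 * real (card S)"
        using S(3) unfolding XX n_def[symmetric] .
      finally have "\<delta> / 2 * (n / (2 * k)) * \<tau> * n / (k * n) ^ 3 \<le> real (card S)"
        using n k0 by (subst pos_divide_le_eq) (auto simp: mult.commute)
      moreover have "\<delta> / 2 * (n / (2 * k)) * \<tau> * n / (k * n) ^ 3 = \<delta> ^ (2 * T + 1) * n / (8 * k ^ 8)"
        using n k0 by (simp add: \<tau>_def field_simps eval_nat_numeral)
      ultimately show False
        using none S by (auto simp: n_def)
    qed
    then obtain U' V' where *: "U' \<subseteq> U" "V' \<subseteq> V" "\<delta> * real (card U) \<le> real (card U')"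
      "\<delta> * real (card V) \<le> real (card V')" "real (card (popular A U' V' \<tau>)) \<le> (1 - \<delta> / 2) * p"
      using product_free_or_fewer_popular[OF EH \<delta>(1) X(1,2) A(1) _ UV(2) U V \<tau>] UV(1) A(1)
      unfolding p_def by blast
    have "\<delta> ^ Suc t * real (card A) \<le> real (card U')" "\<delta> ^ Suc t * n \<le> real (card V')"
      using *(3,4) mult_left_mono[OF UV(3), of \<delta>] mult_left_mono[OF UV(4), of \<delta>] \<delta>(1)
      unfolding power_Suc mult.assoc by linarith+
    moreover have "real (card (popular A U' V' \<tau>)) \<le> (1 - \<delta> / 2) ^ Suc t * (k ^ 2 * n)"
      using *(5) mult_left_mono[OF UV(5), of "1 - \<delta> / 2"] \<delta>
      unfolding power_Suc mult.assoc p_def by linarith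
    ultimately show ?case
      using * UV by (meson subset_trans)
  qed
  from this[OF order_refl] obtain U V where UV: "U \<subseteq> A" "V \<subseteq> X" "\<delta> ^ T * real (card A) \<le> real (card U)"
      "\<delta> ^ T * n \<le> real (card V)" "real (card (popular A U V \<tau>)) \<le> (1 - \<delta> / 2) ^ T * (k ^ 2 * n)"
    by auto
  have "n / (2 * k) \<le> (1 - \<delta> / 2) ^ T * (k ^ 2 * n)"
    using popular_ge[OF UV(1-4)] UV(5) by simp
  then have "1 \<le> (1 - \<delta> / 2) ^ T * (2 * k ^ 3)"
    using n k0 by (simp add: field_simps eval_nat_numeral)
  then show False
    using T by simp
qed

end

section \<open>Polynomial bounds\<close>

lemma (in group) singleton_product_free:
  assumes "x \<in> carrier G" "x \<noteq> \<one>"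
  shows "product_free G {x}"
  using assms by (simp add: product_free_def)

lemma (in group) product_Erdos_Hajnal_if_strong:
  assumes "strong_Erdos_Hajnal 6 (\<lambda>_. carrier G) (triple_product_relation G)"
  shows "\<exists>\<delta>>0. \<delta> < 1 \<and> product_Erdos_Hajnal \<delta>"
proof -
  obtain \<delta> :: real where \<delta>: "0 < \<delta>" "\<delta> < 1"
    and EH: "\<And>W. \<forall>i\<in>{1..6}. W i \<subseteq> carrier G \<and> finite (W i) \<Longrightarrow>
         \<exists>U. (\<forall>i\<in>{1..6}. U i \<subseteq> W i \<and> \<delta> * real (card (W i)) \<le> real (card (U i))) \<and>
              homogeneous 6 (triple_product_relation G) U"
    using assms unfolding strong_Erdos_Hajnal_def by blast
  have six: "{1..6::nat} = {1, 2, 3, 4, 5, 6}"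
    by auto
  have "product_Erdos_Hajnal \<delta>"
    unfolding product_Erdos_Hajnal_def
  proof (intro allI impI, elim conjE)
    fix A B C assume car: "A \<subseteq> carrier G" "B \<subseteq> carrier G" "C \<subseteq> carrier G"
      and fin: "finite A" "finite B" "finite C"
    \<comment> \<open>A subset of \<open>{\<one>}\<close> of positive proportion is \<open>{\<one>}\<close>, which removes the coordinates \<open>3\<close>, \<open>5\<close>, \<open>6\<close>.\<close>
    define W :: "nat \<Rightarrow> 'a set" where "W = (\<lambda>_. {\<one>})(1 := A, 2 := B, 4 := C)"
    have "\<forall>i\<in>{1..6}. W i \<subseteq> carrier G \<and> finite (W i)"
      using car fin by (auto simp: W_def)
    then obtain U where U: "\<And>i. i \<in> {1..6} \<Longrightarrow> U i \<subseteq> W i \<and> \<delta> * real (card (W i)) \<le> real (card (U i))"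
      and hom: "homogeneous 6 (triple_product_relation G) U"
      using EH[of W] by blast
    have one: "U i = {\<one>}" if "i \<in> {3, 5, 6}" for i
    proof -
      have "U i \<subseteq> {\<one>}" "0 < real (card (U i))"
        using U[of i] that \<delta> by (auto simp: W_def)
      then show ?thesis
        by (auto simp: card_gt_0_iff)
    qed
    define tup :: "'a \<Rightarrow> 'a \<Rightarrow> 'a \<Rightarrow> nat \<Rightarrow> 'a" where
      "tup a b c = restrict ((\<lambda>_. \<one>)(1 := a, 2 := b, 4 := c)) {1..6}" for a b c
    have sub: "U 1 \<subseteq> A" "U 2 \<subseteq> B" "U 4 \<subseteq> C"
      using U[of 1] U[of 2] U[of 4] by (auto simp: W_def)
    have tup: "tup a b c \<in> (\<Pi>\<^sub>E i\<in>{1..6}. U i)"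
      and tup_iff: "tup a b c \<in> triple_product_relation G \<longleftrightarrow> a \<otimes> b = c"
      if "a \<in> U 1" "b \<in> U 2" "c \<in> U 4" for a b c
    proof -
      have "a \<in> carrier G" "b \<in> carrier G" "c \<in> carrier G"
        using that sub car by auto
      then show "tup a b c \<in> triple_product_relation G \<longleftrightarrow> a \<otimes> b = c"
        by (auto simp: triple_product_relation_def tup_def)
      show "tup a b c \<in> (\<Pi>\<^sub>E i\<in>{1..6}. U i)"
        using that one unfolding tup_def six by auto
    qed
    have "(\<forall>a\<in>U 1. \<forall>b\<in>U 2. \<forall>c\<in>U 4. a \<otimes> b = c) \<or> (\<forall>a\<in>U 1. \<forall>b\<in>U 2. \<forall>c\<in>U 4. a \<otimes> b \<noteq> c)"
      using hom unfolding homogeneous_def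
    proof
      assume "(\<Pi>\<^sub>E i\<in>{1..6}. U i) \<subseteq> triple_product_relation G"
      then show ?thesis
        using tup tup_iff by blast
    next
      assume "(\<Pi>\<^sub>E i\<in>{1..6}. U i) \<inter> triple_product_relation G = {}"
      then show ?thesis
        using tup tup_iff by blast
    qed
    moreover have "\<delta> * real (card A) \<le> real (card (U 1))" "\<delta> * real (card B) \<le> real (card (U 2))"
      "\<delta> * real (card C) \<le> real (card (U 4))"
      using U[of 1] U[of 2] U[of 4] by (auto simp: W_def)
    ultimately show "\<exists>A'\<subseteq>A. \<exists>B'\<subseteq>B. \<exists>C'\<subseteq>C.
          \<delta> * real (card A) \<le> real (card A') \<and> \<delta> * real (card B) \<le> real (card B') \<and>
          \<delta> * real (card C) \<le> real (card C') \<and>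
          ((\<forall>a\<in>A'. \<forall>b\<in>B'. \<forall>c\<in>C'. a \<otimes> b = c) \<or> (\<forall>a\<in>A'. \<forall>b\<in>B'. \<forall>c\<in>C'. a \<otimes> b \<noteq> c))"
      using sub by blast
  qed
  then show ?thesis
    using \<delta> by blast
qed

text \<open>Since \<open>1 - \<delta>/2 \<le> exp (- \<delta>/2)\<close>, some \<open>T \<le> 2 ln (2 k\<^sup>3) / \<delta> + 1\<close> suffices for the first claim; the
  second expresses \<open>\<delta>^(2 T + 1)\<close> for this logarithmic \<open>T\<close> as a power of \<open>k\<close>, whose exponent depends on
  \<open>\<delta>\<close> only.\<close>

lemma exists_number_of_steps:
  fixes \<delta> k :: real
  assumes \<delta>: "0 < \<delta>" "\<delta> < 1" and k: "1 \<le> k"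
  defines "a \<equiv> 4 * ln (1 / \<delta>) / \<delta>"
  shows "\<exists>T. (1 - \<delta> / 2) ^ T * (2 * k ^ 3) < 1 \<and> \<delta> ^ 3 * 2 powr - a * k powr (- (3 * a)) \<le> \<delta> ^ (2 * T + 1)"
proof -
  define L where "L = ln 2 + 3 * ln k"
  have L: "0 < L"
    using k by (simp add: L_def add_pos_nonneg)
  have expL: "exp L = 2 * k ^ 3"
    using k exp_of_nat_mult[of 3 "ln k"] by (simp add: L_def exp_add)
  define T where "T = nat \<lfloor>2 * L / \<delta>\<rfloor> + 1"
  have T: "2 * L / \<delta> < real T" "real T \<le> 2 * L / \<delta> + 1"
    using L \<delta> by (auto simp: T_def) linarith+
  have "(1 - \<delta> / 2) ^ T \<le> exp (- (\<delta> / 2)) ^ T"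
    using exp_ge_add_one_self[of "- (\<delta> / 2)"] \<delta> by (intro power_mono) auto
  also have "\<dots> = exp (- (\<delta> / 2 * real T))"
    by (simp flip: exp_of_nat_mult add: mult.commute)
  also have "\<dots> < exp (- L)"
    using T(1) \<delta> by (simp add: field_simps)
  finally have "(1 - \<delta> / 2) ^ T * exp L < 1"
    by (simp add: exp_minus field_simps)
  then have 1: "(1 - \<delta> / 2) ^ T * (2 * k ^ 3) < 1"
    by (simp only: expL)
  have "\<delta> ^ 3 * 2 powr - a * k powr (- (3 * a)) = exp (3 * ln \<delta>) * exp (- a * ln 2) * exp (- (3 * a) * ln k)"
    using \<delta> k exp_of_nat_mult[of 3 "ln \<delta>"] by (simp add: powr_def)
  also have "\<dots> = exp (ln \<delta> * 3 - a * L)"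
    by (simp add: L_def algebra_simps flip: exp_add)
  also have "ln \<delta> * 3 - a * L = ln \<delta> * (4 * L / \<delta> + 3)"
    using \<delta> by (simp add: a_def ln_div algebra_simps)
  also have "\<dots> \<le> ln \<delta> * real (2 * T + 1)"
    using T(2) \<delta> by (intro mult_left_mono_neg) auto
  also have "exp \<dots> = \<delta> ^ (2 * T + 1)"
    using \<delta> exp_of_nat_mult[of "2 * T + 1" "ln \<delta>"] by (simp add: mult.commute)
  finally have "\<delta> ^ 3 * 2 powr - a * k powr (- (3 * a)) \<le> \<delta> ^ (2 * T + 1)"
    by simp
  then show ?thesis
    using 1 by blast
qed

lemma (in group) exists_large_product_free_subset:
  assumes "strong_Erdos_Hajnal 6 (\<lambda>_. carrier G) (triple_product_relation G)"
  shows "\<exists>c\<^sub>2 \<epsilon>\<^sub>2 :: real. c\<^sub>2 > 0 \<and> 0 < \<epsilon>\<^sub>2 \<and> \<epsilon>\<^sub>2 < 1 \<and>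
           (\<forall>X k. X \<subseteq> carrier G \<and> finite X \<and> X \<noteq> {} \<and> X \<noteq> {\<one>} \<and>
                  k = real (card (X <#> X)) / real (card X) \<longrightarrow>
              (\<exists>S \<subseteq> X. product_free G S \<and>
                 real (card S) \<ge> \<epsilon>\<^sub>2 * real (card X) / k powr c\<^sub>2))"
proof -
  obtain \<delta> where \<delta>: "0 < \<delta>" "\<delta> < 1" and EH: "product_Erdos_Hajnal \<delta>"
    using product_Erdos_Hajnal_if_strong[OF assms] by blast
  define a where "a = 4 * ln (1 / \<delta>) / \<delta>"
  have a: "0 < a"
    using \<delta> by (simp add: a_def)
  \<comment> \<open>With these constants \<open>\<epsilon> n / k^c\<close> is at most \<open>\<delta>^(2 T + 1) n / (8 k^8)\<close>.\<close>
  define c where "c = 3 * a + 8"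
  define \<epsilon> where "\<epsilon> = \<delta> ^ 3 * 2 powr - a / 8"
  have "\<delta> ^ 3 < 1" "2 powr - a < (1::real)"
    using \<delta> a by (auto simp: power_less_one_iff powr_less_one)
  then have "\<delta> ^ 3 * 2 powr - a < 1 * 1"
    using \<delta> by (intro mult_strict_mono) auto
  then have \<epsilon>: "0 < \<epsilon>" "\<epsilon> < 1"
    using \<delta> by (auto simp: \<epsilon>_def)
  have main: "\<exists>S\<subseteq>X. product_free G S \<and> \<epsilon> * real (card X) / k powr c \<le> real (card S)"
    if X: "X \<subseteq> carrier G" "finite X" "X \<noteq> {}" "X \<noteq> {\<one>}"
      and k: "k = real (card (X <#> X)) / real (card X)" for X k
  proof -
    define n where "n = real (card X)"
    have n: "0 < n"
      using X by (simp add: n_def card_gt_0_iff)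
    obtain y where y: "y \<in> X"
      using X by blast
    have "card X = card ((\<lambda>x. y \<otimes> x) ` X)"
      using card_left_translate[of y X] y X by auto
    also have "\<dots> \<le> card (X <#> X)"
      using X y by (intro card_mono finite_set_mult) (auto simp: set_mult_def)
    finally have k1: "1 \<le> k"
      using n by (simp add: k n_def)
    obtain T where T: "(1 - \<delta> / 2) ^ T * (2 * k ^ 3) < 1"
      "\<delta> ^ 3 * 2 powr - a * k powr (- (3 * a)) \<le> \<delta> ^ (2 * T + 1)"
      using exists_number_of_steps[OF \<delta> k1] unfolding a_def by blast
    have k8: "k powr c = k powr (3 * a) * k ^ 8"
      using k1 by (simp add: c_def powr_add powr_realpow flip: powr_numeral)
    have "\<epsilon> * n / k powr c = (\<delta> ^ 3 * 2 powr - a * k powr (- (3 * a))) * (n / (8 * k ^ 8))"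
      by (simp add: \<epsilon>_def k8 powr_minus field_simps)
    also have "\<dots> \<le> \<delta> ^ (2 * T + 1) * (n / (8 * k ^ 8))"
      using T(2) n k1 by (intro mult_right_mono) auto
    finally have bound: "\<epsilon> * n / k powr c \<le> \<delta> ^ (2 * T + 1) * n / (8 * k ^ 8)"
      by simp
    show ?thesis
    proof (cases "1 < \<delta> ^ (T + 1) * n / k")
      case True
      then obtain S where "S \<subseteq> X" "product_free G S"
        "\<delta> ^ (2 * T + 1) * n / (8 * k ^ 8) \<le> real (card S)"
        using exists_product_free_of_many_steps[OF EH \<delta> X(1-3) k T(1)] unfolding n_def by blast
      then show ?thesis
        using bound unfolding n_def by (intro exI[of _ S] conjI) linarith+
    next
      case False
      obtain x where x: "x \<in> X" "x \<noteq> \<one>"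
        using X by blast
      \<comment> \<open>The bound to be reached is now at most \<open>1\<close>.\<close>
      have "k ^ 1 \<le> k ^ 8"
        using k1 by (intro power_increasing) auto
      then have "\<delta> ^ (2 * T + 1) * n / (8 * k ^ 8) \<le> \<delta> ^ (T + 1) * n / k"
        using \<delta> n k1 by (intro frac_le mult_right_mono power_decreasing mult_nonneg_nonneg) auto
      then have "\<epsilon> * n / k powr c \<le> real (card {x})"
        using False bound by simp
      then show ?thesis
        using singleton_product_free[of x] x X by (intro exI[of _ "{x}"]) (auto simp: n_def)
    qed
  qed
  show ?thesis
    using main a \<epsilon> by (intro exI[of _ c] exI[of _ \<epsilon>]) (auto simp: c_def)
qed

theorem theorem3p3:
  fixes G :: "('a, 'b) monoid_scheme"
  assumes "group G"
    and "strong_Erdos_Hajnal 6 (\<lambda>_. carrier G) (triple_product_relation G)"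
  shows "\<exists>c\<^sub>2 \<epsilon>\<^sub>2 :: real. c\<^sub>2 > 0 \<and> 0 < \<epsilon>\<^sub>2 \<and> \<epsilon>\<^sub>2 < 1 \<and>
           (\<forall>X k. X \<subseteq> carrier G \<and> finite X \<and> X \<noteq> {} \<and> X \<noteq> {\<one>\<^bsub>G\<^esub>} \<and>
                  k = real (card (X <#>\<^bsub>G\<^esub> X)) / real (card X) \<longrightarrow>
              (\<exists>S \<subseteq> X. product_free G S \<and>
                 real (card S) \<ge> \<epsilon>\<^sub>2 * real (card X) / k powr c\<^sub>2))"
  using group.exists_large_product_free_subset[OF assms] .

end
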